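(* For $f\in\mathcal{F}$ and $\delta f_1,\delta f_2\in T_f\mathcal{F}$ let $(\!(\delta f_1,\delta f_2)\!)_f=\langle\!\langle \delta f_1^{\perp},\delta f_2^{\perp}\rangle\!\rangle_f$, where $\langle\!\langle\cdot,\cdot\rangle\!\rangle$ is the elastic metric and $\delta f^{\perp}=(\delta f\cdot n_f)\,n_f$ is the normal component of $\delta f$. Then $(\!(\cdot,\cdot)\!)$ is gauge invariant: for every path $\Psi\in\mathcal{C}^\infty([0,1],\mathcal{F})$ and every time-dependent reparameterization $\gamma\in\mathcal{C}^\infty([0,1],\mathrm{Diff}^+(\mathbb{S}^2))$, setting $\tilde\Psi(t)=\Psi(t)\circ\gamma(t)$, one has $$L[\Psi]=L[\tilde\Psi],\qquad\text{where } L[\Psi]=\int_0^1(\!(\Psi_t(t),\Psi_t(t))\!)_{\Psi(t)}^{1/2}\,dt,\quad \Psi_t=\tfrac{d\Psi}{dt}.$$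
   Context: $\mathcal{F}$ is the set of smooth embeddings $f:\mathbb{S}^2\to\mathbb{R}^3$, an open subset of $\mathcal{C}^\infty(\mathbb{S}^2,\mathbb{R}^3)$, so $T_f\mathcal{F}=\mathcal{C}^\infty(\mathbb{S}^2,\mathbb{R}^3)$. $\mathrm{Diff}^+(\mathbb{S}^2)$ is the group of orientation-preserving smooth diffeomorphisms of $\mathbb{S}^2$. For $f\in\mathcal{F}$ and local coordinates $(u,v)$ on $\mathbb{S}^2$ (compatible with its orientation), let $g=\mathrm{Jac}(f)^T\mathrm{Jac}(f)$, with $\mathrm{Jac}(f)=[f_u\ f_v]$, be the matrix of the pull-back of the Euclidean metric, $|g|^{1/2}=\sqrt{\det g}$, and $n_f=\frac{f_u\times f_v}{\|f_u\times f_v\|}$ the unit normal field. For $\delta f_i\in T_f\mathcal{F}$ let $(\delta g_i,\delta n_i)$ be the derivative at $f$ in the direction $\delta f_i$ of the map $f\mapsto(g,n_f)$. The elastic metric with constant weights $a,b,c$ is $$\langle\!\langle\delta f_1,\delta f_2\rangle\!\rangle_f=\int_{\mathbb{S}^2}ds\,|g|^{1/2}\left\{a\,\mathrm{Tr}\big((g^{-1}\delta g_1)_{\mathbf 0}(g^{-1}\delta g_2)_{\mathbf 0}\big)+b\,\mathrm{Tr}(g^{-1}\delta g_1)\mathrm{Tr}(g^{-1}\delta g_2)+c\,\delta n_1\cdot\delta n_2\right\},$$ where $A_{\mathbf 0}=A-\frac{\mathrm{Tr}(A)}{2}I_{2\times2}$ is the traceless part of a $2\times 2$ matrix $A$, and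 $ds\,|g|^{1/2}$ (with $ds=du\,dv$ in coordinates) denotes the area measure of the Riemannian metric $g$ on $\mathbb{S}^2$. The weights satisfy $a,b,c\ge 0$. *)

theory Defs
  imports "HOL-Analysis.Analysis"
begin

section \<open>Smooth maps on open subsets of the plane\<close>

text \<open>Iterated partial derivatives, indexed by the list of the coordinate directions.\<close>

primrec partials :: "2 list \<Rightarrow> (real^2 \<Rightarrow> 'b::real_normed_vector) \<Rightarrow> real^2 \<Rightarrow> 'b" where
  "partials [] h = h"
| "partials (i # is) h = (\<lambda>x. frechet_derivative (partials is h) (at x) (axis i 1))"

definition smooth_on :: "(real^2) set \<Rightarrow> (real^2 \<Rightarrow> 'b::real_normed_vector) \<Rightarrow> bool" where
  "smooth_on U h \<longleftrightarrow> open U \<and> (\<forall>is. \<forall>x\<in>U. partials is h differentiable (at x))"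

section \<open>The oriented smooth manifold \<open>S\<^sup>2\<close>\<close>

text \<open>Maps on the sphere are represented by functions on the ambient space; their values off the
  sphere play no role.\<close>

abbreviation S2 :: "(real^3) set" where
  "S2 \<equiv> sphere 0 1"

abbreviation d_u :: "(real^2 \<Rightarrow> real^3) \<Rightarrow> real^2 \<Rightarrow> real^3" where
  "d_u h x \<equiv> column 1 (jacobian h (at x))"

abbreviation d_v :: "(real^2 \<Rightarrow> real^3) \<Rightarrow> real^2 \<Rightarrow> real^3" where
  "d_v h x \<equiv> column 2 (jacobian h (at x))"

text \<open>A chart is given by its inverse, a regular parametrization of an open part of the sphere. The
  sphere is oriented by its outer normal, so the last condition states both that the
  parametrization is regular and that it is compatible with the orientation.\<close>

definition oriented_chart :: "(real^2) set \<Rightarrow> (real^2 \<Rightarrow> real^3) \<Rightarrow> bool" where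
  "oriented_chart U \<phi> \<longleftrightarrow>
     smooth_on U \<phi> \<and> openin (top_of_set S2) (\<phi> ` U) \<and> (\<exists>\<psi>. homeomorphism U (\<phi> ` U) \<phi> \<psi>) \<and>
     (\<forall>x\<in>U. cross3 (d_u \<phi> x) (d_v \<phi> x) \<bullet> \<phi> x > 0)"

definition smooth_S2 :: "(real^3 \<Rightarrow> real^3) set" where
  "smooth_S2 = {h. \<forall>U \<phi>. oriented_chart U \<phi> \<longrightarrow> smooth_on U (h \<circ> \<phi>)}"

definition embeddings_S2 :: "(real^3 \<Rightarrow> real^3) set" where
  "embeddings_S2 =
     {f \<in> smooth_S2.
        (\<forall>U \<phi>. oriented_chart U \<phi> \<longrightarrow> (\<forall>x\<in>U. inj (frechet_derivative (f \<circ> \<phi>) (at x)))) \<and>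
        (\<exists>h. homeomorphism S2 (f ` S2) f h)}"

definition diff_plus_S2 :: "(real^3 \<Rightarrow> real^3) set" where
  "diff_plus_S2 =
     {\<gamma> \<in> smooth_S2.
        bij_betw \<gamma> S2 S2 \<and> inv_into S2 \<gamma> \<in> smooth_S2 \<and>
        (\<forall>U \<phi>. oriented_chart U \<phi> \<longrightarrow>
           (\<forall>x\<in>U. cross3 (d_u (\<gamma> \<circ> \<phi>) x) (d_v (\<gamma> \<circ> \<phi>) x) \<bullet> \<gamma> (\<phi> x) > 0))}"

section \<open>Smooth paths in the Frechet space of smooth maps\<close>

text \<open>Convergence in the \<open>C\<^sup>\<infinity>\<close> topology: in every chart, all partial derivatives converge
  uniformly on compact sets.\<close>

definition smooth_limit ::
    "('i \<Rightarrow> real^3 \<Rightarrow> real^3) \<Rightarrow> (real^3 \<Rightarrow> real^3) \<Rightarrow> 'i filter \<Rightarrow> bool" where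
  "smooth_limit H h F \<longleftrightarrow>
     (\<forall>U \<phi> K is. oriented_chart U \<phi> \<and> compact K \<and> K \<subseteq> U \<longrightarrow>
        uniform_limit K (\<lambda>s. partials is (H s \<circ> \<phi>)) (partials is (h \<circ> \<phi>)) F)"

definition path_deriv :: "(real \<Rightarrow> real^3 \<Rightarrow> real^3) \<Rightarrow> real \<Rightarrow> real^3 \<Rightarrow> real^3" where
  "path_deriv \<Psi> t = (\<lambda>p. vector_derivative (\<lambda>s. \<Psi> s p) (at t within {0..1}))"

text \<open>Membership in \<open>C\<^sup>\<infinity>([0,1], C\<^sup>\<infinity>(S\<^sup>2, \<real>\<^sup>3))\<close>: every iterated derivative is the limit of
  difference quotients in the \<open>C\<^sup>\<infinity>\<close> topology (one-sided at the end points).\<close>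

definition smooth_path :: "(real \<Rightarrow> real^3 \<Rightarrow> real^3) \<Rightarrow> bool" where
  "smooth_path \<Psi> \<longleftrightarrow>
     (\<forall>k. \<forall>t\<in>{0..1}.
        (path_deriv ^^ k) \<Psi> t \<in> smooth_S2 \<and>
        smooth_limit
          (\<lambda>s p. ((path_deriv ^^ k) \<Psi> s p - (path_deriv ^^ k) \<Psi> t p) /\<^sub>R (s - t))
          ((path_deriv ^^ Suc k) \<Psi> t)
          (at t within {0..1}))"

section \<open>The elastic metric\<close>

definition metric_matrix :: "(real^3 \<Rightarrow> real^3) \<Rightarrow> (real^2 \<Rightarrow> real^3) \<Rightarrow> real^2 \<Rightarrow> real^2^2" where
  "metric_matrix f \<phi> x = transpose (jacobian (f \<circ> \<phi>) (at x)) ** jacobian (f \<circ> \<phi>) (at x)"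

definition coord_normal :: "(real^3 \<Rightarrow> real^3) \<Rightarrow> (real^2 \<Rightarrow> real^3) \<Rightarrow> real^2 \<Rightarrow> real^3" where
  "coord_normal f \<phi> x =
     (let N = cross3 (d_u (f \<circ> \<phi>) x) (d_v (f \<circ> \<phi>) x) in N /\<^sub>R norm N)"

text \<open>The derivatives at \<open>f\<close> in the direction \<open>df\<close>.\<close>

definition delta_metric ::
    "(real^3 \<Rightarrow> real^3) \<Rightarrow> (real^3 \<Rightarrow> real^3) \<Rightarrow> (real^2 \<Rightarrow> real^3) \<Rightarrow> real^2 \<Rightarrow> real^2^2" where
  "delta_metric f df \<phi> x =
     vector_derivative (\<lambda>\<epsilon>. metric_matrix (\<lambda>p. f p + \<epsilon> *\<^sub>R df p) \<phi> x) (at 0)"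

definition delta_normal ::
    "(real^3 \<Rightarrow> real^3) \<Rightarrow> (real^3 \<Rightarrow> real^3) \<Rightarrow> (real^2 \<Rightarrow> real^3) \<Rightarrow> real^2 \<Rightarrow> real^3" where
  "delta_normal f df \<phi> x =
     vector_derivative (\<lambda>\<epsilon>. coord_normal (\<lambda>p. f p + \<epsilon> *\<^sub>R df p) \<phi> x) (at 0)"

definition traceless :: "real^2^2 \<Rightarrow> real^2^2" where
  "traceless A = A - (trace A / 2) *\<^sub>R mat 1"

definition elastic_density ::
    "real \<Rightarrow> real \<Rightarrow> real \<Rightarrow> (real^3 \<Rightarrow> real^3) \<Rightarrow> (real^3 \<Rightarrow> real^3) \<Rightarrow> (real^3 \<Rightarrow> real^3) \<Rightarrow>
     (real^2 \<Rightarrow> real^3) \<Rightarrow> real^2 \<Rightarrow> real" where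
  "elastic_density a b c f df1 df2 \<phi> x =
     (let g = metric_matrix f \<phi> x;
          G1 = matrix_inv g ** delta_metric f df1 \<phi> x;
          G2 = matrix_inv g ** delta_metric f df2 \<phi> x
      in sqrt (det g) *
           (a * trace (traceless G1 ** traceless G2) + b * (trace G1 * trace G2) +
            c * (delta_normal f df1 \<phi> x \<bullet> delta_normal f df2 \<phi> x)))"

text \<open>Integration over the sphere of a density given in coordinates, with respect to \<open>du dv\<close>: cut the
  sphere into finitely many disjoint Borel pieces, each lying in the domain of a chart, and add up
  the coordinate integrals. For a continuous density, i.e. a continuous function times the area
  density of a metric, the sum does not depend on the cutting by the change of variables formula,
  and a cutting into two hemispheres exists, so that the definite description is meaningful.\<close>

definition coordinate_partition ::
    "nat \<Rightarrow> (nat \<Rightarrow> (real^2) set) \<Rightarrow> (nat \<Rightarrow> real^2 \<Rightarrow> real^3) \<Rightarrow> (nat \<Rightarrow> (real^2) set) \<Rightarrow> bool" where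
  "coordinate_partition N U \<phi> A \<longleftrightarrow>
     (\<forall>i<N. oriented_chart (U i) (\<phi> i) \<and> A i \<in> sets borel \<and> A i \<subseteq> U i) \<and>
     disjoint_family_on (\<lambda>i. \<phi> i ` A i) {..<N} \<and> (\<Union>i<N. \<phi> i ` A i) = S2"

definition S2_integral :: "((real^2 \<Rightarrow> real^3) \<Rightarrow> real^2 \<Rightarrow> real) \<Rightarrow> real" where
  "S2_integral \<omega> =
     (THE I. \<forall>N U \<phi> A. coordinate_partition N U \<phi> A \<longrightarrow>
        I = (\<Sum>i<N. set_lebesgue_integral lborel (A i) (\<omega> (\<phi> i))))"

definition elastic_metric ::
    "real \<Rightarrow> real \<Rightarrow> real \<Rightarrow> (real^3 \<Rightarrow> real^3) \<Rightarrow> (real^3 \<Rightarrow> real^3) \<Rightarrow> (real^3 \<Rightarrow> real^3) \<Rightarrow> real" where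
  "elastic_metric a b c f df1 df2 = S2_integral (elastic_density a b c f df1 df2)"

section \<open>The gauge invariant form and the length of a path\<close>

text \<open>The unit normal as a field on the sphere: the common value in all charts around \<open>p\<close>.\<close>

definition unit_normal :: "(real^3 \<Rightarrow> real^3) \<Rightarrow> real^3 \<Rightarrow> real^3" where
  "unit_normal f p =
     (THE n. \<forall>U \<phi> x. oriented_chart U \<phi> \<and> x \<in> U \<and> \<phi> x = p \<longrightarrow> n = coord_normal f \<phi> x)"

definition normal_part :: "(real^3 \<Rightarrow> real^3) \<Rightarrow> (real^3 \<Rightarrow> real^3) \<Rightarrow> real^3 \<Rightarrow> real^3" where
  "normal_part f df = (\<lambda>p. (df p \<bullet> unit_normal f p) *\<^sub>R unit_normal f p)"

definition normal_elastic_metric ::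
    "real \<Rightarrow> real \<Rightarrow> real \<Rightarrow> (real^3 \<Rightarrow> real^3) \<Rightarrow> (real^3 \<Rightarrow> real^3) \<Rightarrow> (real^3 \<Rightarrow> real^3) \<Rightarrow> real" where
  "normal_elastic_metric a b c f df1 df2 =
     elastic_metric a b c f (normal_part f df1) (normal_part f df2)"

definition path_length ::
    "real \<Rightarrow> real \<Rightarrow> real \<Rightarrow> (real \<Rightarrow> real^3 \<Rightarrow> real^3) \<Rightarrow> real" where
  "path_length a b c \<Psi> =
     integral {0..1}
       (\<lambda>t. sqrt (normal_elastic_metric a b c (\<Psi> t) (path_deriv \<Psi> t) (path_deriv \<Psi> t)))"

end

theory Submission
  imports Defs
begin

text \<open>The two integrands agree at every time \<open>t\<close>. The velocity of \<open>\<Psi>(t) \<circ> \<gamma>(t)\<close> is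
  \<open>\<Psi>\<^sub>t(t) \<circ> \<gamma>(t)\<close> plus a vector tangent to the surface \<open>\<Psi>(t)(S\<^sup>2)\<close>, and the unit normal
  of \<open>\<Psi>(t) \<circ> \<gamma>(t)\<close> is that of \<open>\<Psi>(t)\<close> composed with \<open>\<gamma>(t)\<close>; hence the normal part of the velocity
  is just composed with \<open>\<gamma>(t)\<close>. Composition with \<open>\<gamma>(t)\<close> permutes the oriented charts, and reading the
  composed data in a chart \<open>\<phi>\<close> is the same as reading the original data in the chart \<open>\<gamma>(t) \<circ> \<phi>\<close>, so
  the elastic metric does not change. Well-definedness of the normal and the orientation of the
  inverse charts come from comparison with central projections, whose inverses extend
  differentiably to the ambient space.\<close>

lemma smooth_on_differentiable:
  assumes "smooth_on U h" "x \<in> U"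
  shows "h differentiable (at x)"
proof -
  have "partials [] h differentiable (at x)"
    using assms unfolding smooth_on_def by blast
  then show ?thesis by simp
qed

section \<open>Central projection charts of the sphere\<close>

text \<open>For orthonormal \<open>p\<close>, \<open>e\<close> this inverts the central projection
  of the open hemisphere around \<open>p\<close> onto its tangent plane at \<open>p\<close>. The
  frame \<open>p\<close>, \<open>e\<close>, \<open>cross3 p e\<close> is positively oriented, so the
  plane coordinates carry the outward orientation.\<close>

definition gnomonic :: "real^3 \<Rightarrow> real^3 \<Rightarrow> real^2 \<Rightarrow> real^3" where
  "gnomonic p e x =
     (1 / sqrt (1 + (x $ 1)\<^sup>2 + (x $ 2)\<^sup>2)) *\<^sub>R (p + (x $ 1) *\<^sub>R e + (x $ 2) *\<^sub>R cross3 p e)"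

text \<open>Homogeneous of degree zero in \<open>y\<close>, hence constant on rays and meaningful on
  the whole half space \<open>y \<bullet> p > 0\<close>; this makes it differentiable in the ambient
  space.\<close>

definition gnomonic_inv :: "real^3 \<Rightarrow> real^3 \<Rightarrow> real^3 \<Rightarrow> real^2" where
  "gnomonic_inv p e y =
     ((y \<bullet> e) / (y \<bullet> p)) *\<^sub>R axis 1 1 + ((y \<bullet> cross3 p e) / (y \<bullet> p)) *\<^sub>R axis 2 1"

text \<open>An algebra of functions that contains the coefficients of the central projection and is closed
  under partial derivatives; this makes smoothness an induction.\<close>

inductive_set gnomonic_algebra :: "(real^2 \<Rightarrow> real) set" where
  const: "(\<lambda>x. c) \<in> gnomonic_algebra"
| coord: "(\<lambda>x. x $ i) \<in> gnomonic_algebra"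
| radius: "(\<lambda>x. 1 / sqrt (1 + (x $ 1)\<^sup>2 + (x $ 2)\<^sup>2)) \<in> gnomonic_algebra"
| add: "P \<in> gnomonic_algebra \<Longrightarrow> Q \<in> gnomonic_algebra \<Longrightarrow> (\<lambda>x. P x + Q x) \<in> gnomonic_algebra"
| mult: "P \<in> gnomonic_algebra \<Longrightarrow> Q \<in> gnomonic_algebra \<Longrightarrow> (\<lambda>x. P x * Q x) \<in> gnomonic_algebra"

text \<open>The partial derivatives are again polynomials in the coordinates and the radius factor
  itself, which closes \<open>gnomonic_algebra\<close> under differentiation.\<close>

lemma has_derivative_gnomonic_radius:
  fixes x :: "real^2"
  shows "((\<lambda>x::real^2. 1 / sqrt (1 + (x $ 1)\<^sup>2 + (x $ 2)\<^sup>2)) has_derivative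
     (\<lambda>h. - (x $ 1 * h $ 1 + x $ 2 * h $ 2) * (1 / sqrt (1 + (x $ 1)\<^sup>2 + (x $ 2)\<^sup>2)) ^ 3)) (at x)"
proof -
  have pos: "1 + (x $ 1)\<^sup>2 + (x $ 2)\<^sup>2 > 0"
    by (smt (verit) zero_le_power2)
  define s where "s = sqrt (1 + (x $ 1)\<^sup>2 + (x $ 2)\<^sup>2)"
  have s: "s > 0" using pos by (simp add: s_def)
  show ?thesis
    apply (rule has_derivative_eq_rhs)
     apply (rule derivative_eq_intros has_derivative_power refl pos
        bounded_linear.has_derivative[OF bounded_linear_vec_nth] | (use pos s in \<open>simp add: s_def\<close>; fail))+
    using pos s
    unfolding s_def[symmetric]
    by (auto simp: fun_eq_iff field_simps power2_eq_square power3_eq_cube)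
qed

lemma gnomonic_algebra_deriv:
  assumes "P \<in> gnomonic_algebra"
  obtains P' where "\<And>x. (P has_derivative P' x) (at x)"
    "\<And>i. (\<lambda>x. P' x (axis i 1)) \<in> gnomonic_algebra"
proof -
  have "\<exists>P'. (\<forall>x. (P has_derivative P' x) (at x)) \<and> (\<forall>i. (\<lambda>x. P' x (axis i 1)) \<in> gnomonic_algebra)"
    using assms
  proof induction
    case (const c)
    show ?case by (rule exI[of _ "\<lambda>x h. 0"]) (auto intro: gnomonic_algebra.const)
  next
    case (coord j)
    show ?case
      by (rule exI[of _ "\<lambda>x h. h $ j"])
        (auto intro: gnomonic_algebra.const bounded_linear_imp_has_derivative[OF bounded_linear_vec_nth])
  next
    case radius
    let ?r = "\<lambda>x::real^2. 1 / sqrt (1 + (x $ 1)\<^sup>2 + (x $ 2)\<^sup>2)"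
    have "(\<lambda>x. (- 1) * (x $ 1 * (axis i 1 :: real^2) $ 1 + x $ 2 * (axis i 1 :: real^2) $ 2)
        * (?r x * (?r x * ?r x))) \<in> gnomonic_algebra" for i
      by (intro gnomonic_algebra.intros)
    then have "(\<lambda>x. - (x $ 1 * (axis i 1 :: real^2) $ 1 + x $ 2 * (axis i 1 :: real^2) $ 2)
        * ?r x ^ 3) \<in> gnomonic_algebra" for i
      by (simp only: power3_eq_cube mult_minus1 mult.assoc)
    then show ?case
      by (intro exI[of _ "\<lambda>x h. - (x $ 1 * h $ 1 + x $ 2 * h $ 2) * ?r x ^ 3"])
        (auto simp only: has_derivative_gnomonic_radius)
  next
    case (add P Q)
    then obtain P' Q' where "\<forall>x. (P has_derivative P' x) (at x)" "\<forall>x. (Q has_derivative Q' x) (at x)"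
      "\<forall>i. (\<lambda>x. P' x (axis i 1)) \<in> gnomonic_algebra" "\<forall>i. (\<lambda>x. Q' x (axis i 1)) \<in> gnomonic_algebra"
      by blast
    then show ?case
      by (intro exI[of _ "\<lambda>x h. P' x h + Q' x h"])
        (auto intro: gnomonic_algebra.add has_derivative_add)
  next
    case (mult P Q)
    then obtain P' Q' where "\<forall>x. (P has_derivative P' x) (at x)" "\<forall>x. (Q has_derivative Q' x) (at x)"
      "\<forall>i. (\<lambda>x. P' x (axis i 1)) \<in> gnomonic_algebra" "\<forall>i. (\<lambda>x. Q' x (axis i 1)) \<in> gnomonic_algebra"
      by blast
    with mult.hyps show ?case
      by (intro exI[of _ "\<lambda>x h. P x * Q' x h + P' x h * Q x"])
        (auto intro!: has_derivative_mult gnomonic_algebra.add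
          intro: gnomonic_algebra.mult[of P] gnomonic_algebra.mult[of "\<lambda>x. P' x (axis i 1)" Q for i])
  qed
  then show ?thesis using that by blast
qed

text \<open>A partial derivative of such a combination is a combination of the same three vectors
  with new coefficients in the algebra, so induction over the list of directions reaches all
  iterated partials.\<close>

lemma smooth_on_gnomonic_algebra:
  fixes u v w :: "'b::real_normed_vector"
  assumes "P \<in> gnomonic_algebra" "Q \<in> gnomonic_algebra" "R \<in> gnomonic_algebra"
  shows "smooth_on UNIV (\<lambda>x. P x *\<^sub>R u + Q x *\<^sub>R v + R x *\<^sub>R w)"
proof -
  define comb where "comb = (\<lambda>P Q R x. P x *\<^sub>R u + Q x *\<^sub>R v + (R :: real^2 \<Rightarrow> real) x *\<^sub>R w)"
  have deriv: "\<exists>D. (\<forall>x. (comb P Q R has_derivative D x) (at x)) \<and>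
      (\<forall>i. \<exists>P'\<in>gnomonic_algebra. \<exists>Q'\<in>gnomonic_algebra. \<exists>R'\<in>gnomonic_algebra.
        (\<lambda>x. D x (axis i 1)) = comb P' Q' R')"
    if PQR: "P \<in> gnomonic_algebra" "Q \<in> gnomonic_algebra" "R \<in> gnomonic_algebra" for P Q R
  proof -
    obtain P' where P': "\<And>x. (P has_derivative P' x) (at x)"
      "\<And>i. (\<lambda>x. P' x (axis i 1)) \<in> gnomonic_algebra" using gnomonic_algebra_deriv[OF PQR(1)] by metis
    obtain Q' where Q': "\<And>x. (Q has_derivative Q' x) (at x)"
      "\<And>i. (\<lambda>x. Q' x (axis i 1)) \<in> gnomonic_algebra" using gnomonic_algebra_deriv[OF PQR(2)] by metis
    obtain R' where R': "\<And>x. (R has_derivative R' x) (at x)"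
      "\<And>i. (\<lambda>x. R' x (axis i 1)) \<in> gnomonic_algebra" using gnomonic_algebra_deriv[OF PQR(3)] by metis
    have "(comb P Q R has_derivative (\<lambda>h. P' x h *\<^sub>R u + Q' x h *\<^sub>R v + R' x h *\<^sub>R w)) (at x)" for x
      unfolding comb_def by (intro has_derivative_add has_derivative_scaleR_left P' Q' R')
    then show ?thesis
      using P'(2) Q'(2) R'(2)
      by (intro exI[of _ "\<lambda>x h. P' x h *\<^sub>R u + Q' x h *\<^sub>R v + R' x h *\<^sub>R w"])
        (fastforce simp: comb_def)
  qed
  have partials: "\<exists>P'\<in>gnomonic_algebra. \<exists>Q'\<in>gnomonic_algebra. \<exists>R'\<in>gnomonic_algebra.
      partials is (comb P Q R) = comb P' Q' R'" for "is"
  proof (induction "is")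
    case Nil
    then show ?case using assms by auto
  next
    case (Cons i "is")
    then obtain P' Q' R' where h: "P' \<in> gnomonic_algebra" "Q' \<in> gnomonic_algebra"
      "R' \<in> gnomonic_algebra" "partials is (comb P Q R) = comb P' Q' R'" by blast
    from deriv[OF h(1-3)] obtain D where D: "\<And>x. (comb P' Q' R' has_derivative D x) (at x)"
      and D': "\<exists>P'\<in>gnomonic_algebra. \<exists>Q'\<in>gnomonic_algebra. \<exists>R'\<in>gnomonic_algebra.
        (\<lambda>x. D x (axis i 1)) = comb P' Q' R'" by blast
    have "partials (i # is) (comb P Q R) = (\<lambda>x. D x (axis i 1))"
      using frechet_derivative_at[OF D] by (simp add: h(4))
    with D' show ?case by simp
  qed
  have "partials is (comb P Q R) differentiable (at x)" for "is" x
    using partials[of "is"] deriv unfolding differentiable_def by metis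
  then have "smooth_on UNIV (comb P Q R)" by (simp add: smooth_on_def)
  then show ?thesis by (simp add: comb_def)
qed

section \<open>The central projection as an oriented chart\<close>

abbreviation area_normal :: "(real^2 \<Rightarrow> real^3) \<Rightarrow> real^2 \<Rightarrow> real^3" where
  "area_normal h x \<equiv> cross3 (d_u h x) (d_v h x)"

lemma column_jacobian:
  assumes "(h has_derivative h') (at x)"
  shows "column i (jacobian h (at x)) = h' (axis i 1)"
  using frechet_derivative_at[OF assms]
  by (simp add: jacobian_def column_def matrix_def vec_eq_iff)

lemma gnomonic_oriented_chart:
  assumes p: "norm p = 1" and e: "norm e = 1" and pe: "p \<bullet> e = 0"
  shows "oriented_chart UNIV (gnomonic p e)"
    and "\<And>y. y \<in> S2 \<Longrightarrow> y \<bullet> p > 0 \<Longrightarrow> gnomonic p e (gnomonic_inv p e y) = y"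
    and "\<And>y. y \<bullet> p > 0 \<Longrightarrow> gnomonic_inv p e differentiable (at y)"
proof -
  define e' where "e' = cross3 p e"
  have ip: "p \<bullet> p = 1" "e \<bullet> e = 1" "p \<bullet> e = 0" "e \<bullet> p = 0"
    using p e pe by (simp_all add: norm_eq_1 inner_commute[of e p])
  have ie': "e' \<bullet> p = 0" "p \<bullet> e' = 0" "e' \<bullet> e = 0" "e \<bullet> e' = 0"
    unfolding e'_def by (auto simp: dot_cross_self)
  have ee': "e' \<bullet> e' = 1"
    using norm_cross_dot[of p e] p e pe by (simp add: e'_def power2_norm_eq_inner)
  define r where "r = (\<lambda>x::real^2. 1 / sqrt (1 + (x $ 1)\<^sup>2 + (x $ 2)\<^sup>2))"
  define w where "w = (\<lambda>x::real^2. p + (x $ 1) *\<^sub>R e + (x $ 2) *\<^sub>R e')"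
  have gn: "gnomonic p e = (\<lambda>x. r x *\<^sub>R w x)"
    by (simp add: fun_eq_iff gnomonic_def r_def w_def e'_def)
  have pos: "1 + (x $ 1)\<^sup>2 + (x $ 2)\<^sup>2 > 0" for x :: "real^2"
    by (smt (verit) zero_le_power2)
  have rpos: "r x > 0" for x using pos[of x] by (simp add: r_def)
  have r2: "r x * r x * (1 + (x $ 1)\<^sup>2 + (x $ 2)\<^sup>2) = 1" for x
    using pos[of x] by (simp add: r_def)
  have wp: "w x \<bullet> p = 1" "w x \<bullet> e = x $ 1" "w x \<bullet> e' = x $ 2" for x
    by (simp_all add: w_def inner_add_left ip ie' ee')
  have ww: "w x \<bullet> w x = 1 + (x $ 1)\<^sup>2 + (x $ 2)\<^sup>2" for x
    by (simp add: w_def inner_add_left inner_add_right ip ie' ee' power2_eq_square)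
  have gS2: "gnomonic p e x \<in> S2" for x
  proof -
    have "gnomonic p e x \<bullet> gnomonic p e x = 1"
      using r2[of x] by (simp add: gn ww mult.assoc)
    then show ?thesis by (simp add: norm_eq_1)
  qed
  have ginv: "gnomonic_inv p e (gnomonic p e x) = x" for x
    using rpos[of x]
    by (auto simp: gnomonic_inv_def e'_def[symmetric] gn wp vec_eq_iff forall_2 axis_def)
  \<comment> \<open>The frame is complete: a vector \<open>z\<close> orthogonal to all three has
    \<open>cross3 z (cross3 p e) = 0\<close>, since this expands into multiples of
    \<open>z \<bullet> p\<close> and \<open>z \<bullet> e\<close>; being parallel and orthogonal to
    \<open>e'\<close>, it vanishes.\<close>
  have basis: "y = (y \<bullet> p) *\<^sub>R p + (y \<bullet> e) *\<^sub>R e + (y \<bullet> e') *\<^sub>R e'" for y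
  proof -
    define z where "z = y - ((y \<bullet> p) *\<^sub>R p + (y \<bullet> e) *\<^sub>R e + (y \<bullet> e') *\<^sub>R e')"
    have z: "z \<bullet> p = 0" "z \<bullet> e = 0" "z \<bullet> e' = 0"
      by (simp_all add: z_def inner_diff_left inner_add_left ip ie' ee')
    have "cross3 z e' = 0"
      unfolding e'_def using Lagrange[of z p e] z by simp
    with z(3) have "z = 0 \<or> e' = 0" using norm_and_cross_eq_0 by blast
    then show ?thesis using ee' by (auto simp: z_def)
  qed
  have normy: "y \<bullet> y = (y \<bullet> p)\<^sup>2 + (y \<bullet> e)\<^sup>2 + (y \<bullet> e')\<^sup>2" for y
    using arg_cong[OF basis[of y], of "\<lambda>z. y \<bullet> z"]
    by (simp add: inner_add_right power2_eq_square)
  show gginv: "gnomonic p e (gnomonic_inv p e y) = y" if "y \<in> S2" "y \<bullet> p > 0" for y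
  proof -
    define x where "x = gnomonic_inv p e y"
    have x: "x $ 1 = (y \<bullet> e) / (y \<bullet> p)" "x $ 2 = (y \<bullet> e') / (y \<bullet> p)"
      by (simp_all add: x_def gnomonic_inv_def e'_def axis_def)
    have "(y \<bullet> p)\<^sup>2 + (y \<bullet> e)\<^sup>2 + (y \<bullet> e')\<^sup>2 = 1"
      using that(1) normy[of y] by (simp add: norm_eq_1)
    then have "1 + (x $ 1)\<^sup>2 + (x $ 2)\<^sup>2 = (1 / (y \<bullet> p))\<^sup>2"
      using that(2) by (simp add: x field_simps)
    then have "r x = y \<bullet> p" using that(2) by (simp add: r_def real_sqrt_divide)
    then have "gnomonic p e x = (y \<bullet> p) *\<^sub>R p + (y \<bullet> e) *\<^sub>R e + (y \<bullet> e') *\<^sub>R e'"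
      using that(2) by (simp add: gn w_def x scaleR_add_right)
    then show ?thesis using basis[of y] by (simp add: x_def)
  qed
  have dinv: "gnomonic_inv p e differentiable (at y)" if "y \<bullet> p > 0" for y
    unfolding gnomonic_inv_def using that
    by (auto intro!: derivative_intros)
  then show "\<And>y. y \<bullet> p > 0 \<Longrightarrow> gnomonic_inv p e differentiable (at y)" .
  have "smooth_on UNIV (\<lambda>x. r x *\<^sub>R p + (r x * x $ 1) *\<^sub>R e + (r x * x $ 2) *\<^sub>R e')"
    unfolding r_def by (intro smooth_on_gnomonic_algebra gnomonic_algebra.intros)
  then have sm: "smooth_on UNIV (gnomonic p e)"
    by (simp add: gn w_def algebra_simps)
  have range: "range (gnomonic p e) = S2 \<inter> {y. y \<bullet> p > 0}"
  proof -
    have "gnomonic p e x \<bullet> p > 0" for x using rpos[of x] by (simp add: gn wp)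
    with gS2 have "range (gnomonic p e) \<subseteq> S2 \<inter> {y. y \<bullet> p > 0}" by blast
    moreover have "S2 \<inter> {y. y \<bullet> p > 0} \<subseteq> range (gnomonic p e)"
      using gginv by (metis (no_types, lifting) IntE mem_Collect_eq rangeI subsetI)
    ultimately show ?thesis by (rule equalityI)
  qed
  have contg: "continuous_on UNIV (gnomonic p e)"
    unfolding continuous_on_eq_continuous_within
    using smooth_on_differentiable[OF sm] by (simp add: differentiable_imp_continuous_within)
  have contginv: "continuous_on {y. y \<bullet> p > 0} (gnomonic_inv p e)"
    by (intro differentiable_imp_continuous_on differentiable_at_imp_differentiable_on) (use dinv in auto)
  have area: "area_normal (gnomonic p e) x \<bullet> gnomonic p e x > 0" for x
  proof -
    define r' where "r' = (\<lambda>h::real^2. - (x $ 1 * h $ 1 + x $ 2 * h $ 2) * r x ^ 3)"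
    have r': "(r has_derivative r') (at x)"
      unfolding r_def r'_def by (rule has_derivative_gnomonic_radius)
    have w': "(w has_derivative (\<lambda>h. (h $ 1) *\<^sub>R e + (h $ 2) *\<^sub>R e')) (at x)"
      unfolding w_def
      by (auto intro!: derivative_eq_intros bounded_linear_imp_has_derivative bounded_linear_vec_nth)
    have "(gnomonic p e has_derivative
        (\<lambda>h. r x *\<^sub>R ((h $ 1) *\<^sub>R e + (h $ 2) *\<^sub>R e') + r' h *\<^sub>R w x)) (at x)"
      unfolding gn by (rule has_derivative_scaleR[OF r' w'])
    then have d: "d_u (gnomonic p e) x = r x *\<^sub>R e + r' (axis 1 1) *\<^sub>R w x"
      "d_v (gnomonic p e) x = r x *\<^sub>R e' + r' (axis 2 1) *\<^sub>R w x"
      by (simp_all add: column_jacobian axis_def)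
    \<comment> \<open>The derivative of the factor \<open>r\<close> only adds multiples of
      \<open>w x\<close> to the two columns; these vanish in the triple product with
      \<open>w x\<close>.\<close>
    have triple: "cross3 (s *\<^sub>R b + k *\<^sub>R z) (s *\<^sub>R b' + l *\<^sub>R z) \<bullet> z
        = s * s * (cross3 b b' \<bullet> z)" for s k l b b' z
      by (simp add: cross3_simps)
    have "cross3 e e' = p"
      unfolding e'_def using Lagrange[of e p e] by (simp add: ip)
    then have "area_normal (gnomonic p e) x \<bullet> gnomonic p e x = r x * (r x * r x)"
      unfolding d unfolding gn inner_scaleR_right triple by (simp add: wp inner_commute[of p])
    then show ?thesis using rpos[of x] by simp
  qed
  have "homeomorphism UNIV (range (gnomonic p e)) (gnomonic p e) (gnomonic_inv p e)"
  proof
    show "continuous_on (range (gnomonic p e)) (gnomonic_inv p e)"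
      by (rule continuous_on_subset[OF contginv]) (simp add: range)
  qed (use contg ginv in auto)
  moreover have "openin (top_of_set S2) (range (gnomonic p e))"
    unfolding range by (intro openin_open_Int open_Collect_less continuous_intros)
  ultimately show "oriented_chart UNIV (gnomonic p e)"
    unfolding oriented_chart_def using sm area by auto
qed


text \<open>Derivatives live on open sets, whereas maps of the sphere matter only on
  \<open>S2\<close>. The map \<open>\<pi>\<close> bridges this: it gives coordinates of the points
  of \<open>S2 \<inter> W\<close> and is differentiable in the ambient space, so the ordinary chain
  rule applies to compositions with it.\<close>

definition projected_chart ::
    "(real^2 \<Rightarrow> real^3) \<Rightarrow> (real^3 \<Rightarrow> real^2) \<Rightarrow> (real^3) set \<Rightarrow> bool" where
  "projected_chart \<phi> \<pi> W \<longleftrightarrow>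
     oriented_chart UNIV \<phi> \<and> open W \<and> (\<forall>y\<in>W. \<pi> differentiable (at y)) \<and>
     (\<forall>y\<in>S2 \<inter> W. \<phi> (\<pi> y) = y)"

text \<open>Take the hemisphere centred at \<open>p\<close> itself; \<open>e\<close> is the
  normalized cross product of \<open>p\<close> with any vector not parallel to it.\<close>

lemma projected_chart_exists:
  assumes "p \<in> S2"
  obtains \<phi> \<pi> W where "projected_chart \<phi> \<pi> W" "p \<in> W"
proof -
  have p: "norm p = 1" using assms by simp
  then have "p \<noteq> 0" by auto
  then obtain a where a: "cross3 p a \<noteq> 0" using cross_basis_nonzero by blast
  define e where "e = sgn (cross3 p a)"
  have e: "norm e = 1" "p \<bullet> e = 0"
    using a by (simp_all add: e_def norm_sgn) (simp add: sgn_div_norm dot_cross_self)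
  have "p \<bullet> p = 1" using p by (simp add: norm_eq_1)
  moreover have "open {y. y \<bullet> p > 0}" by (intro open_Collect_less continuous_intros)
  ultimately show ?thesis
    using that[of "gnomonic p e" "gnomonic_inv p e" "{y. y \<bullet> p > 0}"]
      gnomonic_oriented_chart[OF p e]
    by (auto simp: projected_chart_def)
qed

section \<open>Change of charts\<close>

lemma oriented_chartD:
  assumes "oriented_chart U \<phi>"
  shows "open U" "\<And>x. x \<in> U \<Longrightarrow> \<phi> x \<in> S2" "\<And>x. x \<in> U \<Longrightarrow> \<phi> differentiable (at x)"
    "\<And>x. x \<in> U \<Longrightarrow> area_normal \<phi> x \<bullet> \<phi> x > 0"
proof -
  show "\<And>x. x \<in> U \<Longrightarrow> \<phi> x \<in> S2"
    using assms openin_imp_subset unfolding oriented_chart_def by blast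
  show "\<phi> differentiable (at x)" if "x \<in> U" for x
    using assms that smooth_on_differentiable unfolding oriented_chart_def by blast
qed (use assms in \<open>auto simp: oriented_chart_def smooth_on_def\<close>)

lemma smooth_S2_differentiable:
  assumes "f \<in> smooth_S2" "oriented_chart U \<phi>" "x \<in> U"
  shows "(f \<circ> \<phi>) differentiable (at x)"
  using assms smooth_on_differentiable unfolding smooth_S2_def by blast

text \<open>\<open>frechet_derivative\<close> is a choice among all derivatives. Both functions have
  the same derivatives at \<open>x\<close>, so the choices coincide even where no derivative
  exists.\<close>

lemma frechet_derivative_cong_open:
  assumes "open V" "x \<in> V" "\<And>y. y \<in> V \<Longrightarrow> h y = k y"
  shows "frechet_derivative h (at x) = frechet_derivative k (at x)"
proof -
  have "(h has_derivative D) (at x) \<longleftrightarrow> (k has_derivative D) (at x)" for D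
    using has_derivative_transform_within_open[of h D x UNIV V k]
      has_derivative_transform_within_open[of k D x UNIV V h] assms by auto
  then show ?thesis by (simp add: frechet_derivative_def)
qed

lemma jacobian_cong_open:
  assumes "open V" "x \<in> V" "\<And>y. y \<in> V \<Longrightarrow> h y = k y"
  shows "jacobian h (at x) = jacobian k (at x)"
  using frechet_derivative_cong_open[OF assms] by (simp add: jacobian_def)

lemma linear_axis_2:
  assumes "linear (L :: real^2 \<Rightarrow> 'b::real_vector)"
  shows "L v = (v $ 1) *\<^sub>R L (axis 1 1) + (v $ 2) *\<^sub>R L (axis 2 1)"
proof -
  have "v = (v $ 1) *\<^sub>R axis 1 1 + (v $ 2) *\<^sub>R axis 2 1"
    by (simp add: vec_eq_iff forall_2 axis_def)
  then show ?thesis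
    using linear_add[OF assms] linear_scale[OF assms] by metis
qed

text \<open>By the chain rule the new columns are combinations of the columns for \<open>h\<close>
  with the entries of the Jacobian of \<open>\<tau>\<close> as coefficients; the cross product is
  bilinear and alternating.\<close>

lemma area_normal_compose:
  assumes h: "h differentiable (at (\<tau> x))" and \<tau>: "\<tau> differentiable (at x)"
  shows "area_normal (h \<circ> \<tau>) x = det (jacobian \<tau> (at x)) *\<^sub>R area_normal h (\<tau> x)"
proof -
  obtain L where L: "(h has_derivative L) (at (\<tau> x))" using h by (auto simp: differentiable_def)
  obtain M where M: "(\<tau> has_derivative M) (at x)" using \<tau> by (auto simp: differentiable_def)
  have LM: "(h \<circ> \<tau> has_derivative L \<circ> M) (at x)" by (rule diff_chain_at[OF M L])
  have lin: "linear L" using has_derivative_linear[OF L] .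
  have J: "jacobian \<tau> (at x) $ i $ j = M (axis j 1) $ i" for i j
    using frechet_derivative_at[OF M] by (simp add: jacobian_def matrix_def)
  have cross: "cross3 (a *\<^sub>R u + b *\<^sub>R v) (c *\<^sub>R u + d *\<^sub>R v) = (a * d - b * c) *\<^sub>R cross3 u v"
    for a b c d u v
    by (simp add: cross3_simps forall_3)
  show ?thesis
    unfolding column_jacobian[OF LM] column_jacobian[OF L] comp_apply
      linear_axis_2[OF lin, of "M (axis 1 1)"] linear_axis_2[OF lin, of "M (axis 2 1)"]
    by (simp add: cross det_2 J mult.commute)
qed

lemma projected_chart_local:
  assumes pc: "projected_chart \<phi> \<pi> W" and U: "open U" "x \<in> U" and S2: "\<And>y. y \<in> U \<Longrightarrow> \<eta> y \<in> S2"
    and \<eta>: "\<eta> differentiable (at x)" and W: "\<eta> x \<in> W"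
  obtains V where "open V" "x \<in> V" "\<And>y. y \<in> V \<Longrightarrow> \<phi> (\<pi> (\<eta> y)) = \<eta> y"
proof -
  have "open W" using pc by (simp add: projected_chart_def)
  then obtain T where "open T" "x \<in> T" "\<And>y. y \<in> T \<Longrightarrow> \<eta> y \<in> W"
    using differentiable_imp_continuous_within[OF \<eta>] W continuous_at_open by metis
  then show ?thesis
    using that[of "U \<inter> T"] U S2 pc unfolding projected_chart_def by auto
qed

text \<open>The factor does not depend on \<open>f\<close>: it is the Jacobian determinant of the change of charts.\<close>

lemma area_normal_transition:
  assumes pc: "projected_chart \<phi> \<pi> W" and U: "open U" "x \<in> U" and S2: "\<And>y. y \<in> U \<Longrightarrow> \<eta> y \<in> S2"
    and \<eta>: "\<eta> differentiable (at x)" and W: "\<eta> x \<in> W" and f: "(f \<circ> \<phi>) differentiable (at (\<pi> (\<eta> x)))"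
  shows "area_normal (f \<circ> \<eta>) x =
    det (jacobian (\<pi> \<circ> \<eta>) (at x)) *\<^sub>R area_normal (f \<circ> \<phi>) (\<pi> (\<eta> x))"
proof -
  obtain V where V: "open V" "x \<in> V" "\<And>y. y \<in> V \<Longrightarrow> \<phi> (\<pi> (\<eta> y)) = \<eta> y"
    using projected_chart_local[OF pc U S2 \<eta> W] by metis
  have "jacobian (f \<circ> \<eta>) (at x) = jacobian ((f \<circ> \<phi>) \<circ> (\<pi> \<circ> \<eta>)) (at x)"
    by (rule jacobian_cong_open[OF V(1,2)]) (simp add: V(3))
  moreover have "(\<pi> \<circ> \<eta>) differentiable (at x)"
    using pc W \<eta> by (intro differentiable_chain_at) (auto simp: projected_chart_def)
  ultimately show ?thesis
    using area_normal_compose[of "f \<circ> \<phi>" "\<pi> \<circ> \<eta>" x] f by simp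
qed

text \<open>The Jacobian determinant of the change of charts is positive, as the case
  \<open>f = id\<close> shows: there both area normals point outwards. It depends only on the charts
  and the point, hence is obtained before \<open>f\<close>.\<close>

lemma chart_transition:
  assumes pc: "projected_chart \<phi> \<pi> W" and \<eta>: "oriented_chart U \<eta>" "x \<in> U" and W: "\<eta> x \<in> W"
  obtains d where "d > 0" "\<And>f. f \<in> smooth_S2 \<Longrightarrow>
    area_normal (f \<circ> \<eta>) x = d *\<^sub>R area_normal (f \<circ> \<phi>) (\<pi> (\<eta> x))"
proof -
  have \<phi>: "oriented_chart UNIV \<phi>" using pc by (simp add: projected_chart_def)
  let ?d = "det (jacobian (\<pi> \<circ> \<eta>) (at x))" and ?z = "\<pi> (\<eta> x)"
  have tr: "area_normal (f \<circ> \<eta>) x = ?d *\<^sub>R area_normal (f \<circ> \<phi>) ?z"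
    if "(f \<circ> \<phi>) differentiable (at ?z)" for f
    using area_normal_transition[OF pc] oriented_chartD[OF \<eta>(1)] \<eta>(2) W that by metis
  have "area_normal \<eta> x = ?d *\<^sub>R area_normal \<phi> ?z"
    using tr[of id] oriented_chartD(3)[OF \<phi>] by simp
  moreover have "\<phi> ?z = \<eta> x"
    using pc oriented_chartD(2)[OF \<eta>] W by (simp add: projected_chart_def)
  ultimately have "?d * (area_normal \<phi> ?z \<bullet> \<phi> ?z) > 0"
    using oriented_chartD(4)[OF \<eta>] by (metis inner_scaleR_left)
  then have "?d > 0"
    using oriented_chartD(4)[OF \<phi>, of ?z] by (simp add: zero_less_mult_iff)
  then show ?thesis
    using that[of ?d] tr smooth_S2_differentiable[OF _ \<phi>] by simp
qed

section \<open>The unit normal as a field on the sphere\<close>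

lemma coord_normal_eq_sgn: "coord_normal f \<phi> x = sgn (area_normal (f \<circ> \<phi>) x)"
  by (simp add: coord_normal_def Let_def sgn_div_norm)

text \<open>All coordinate normals at the point are compared with the one in a single projected
  chart: the area normals differ by a positive factor, which \<open>sgn\<close> removes. Hence the
  definite description has a value, and the given chart makes it unique.\<close>

lemma unit_normal_eq:
  assumes f: "f \<in> smooth_S2" and \<eta>: "oriented_chart U \<eta>" "x \<in> U"
  shows "unit_normal f (\<eta> x) = coord_normal f \<eta> x"
proof -
  obtain \<phi> \<pi> W where pc: "projected_chart \<phi> \<pi> W" "\<eta> x \<in> W"
    using projected_chart_exists oriented_chartD(2)[OF \<eta>] by metis
  have eq: "coord_normal f \<eta>' x' = sgn (area_normal (f \<circ> \<phi>) (\<pi> (\<eta> x)))"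
    if c: "oriented_chart U' \<eta>'" "x' \<in> U'" "\<eta>' x' = \<eta> x" for U' \<eta>' x'
  proof -
    obtain d where "d > 0" "area_normal (f \<circ> \<eta>') x' = d *\<^sub>R area_normal (f \<circ> \<phi>) (\<pi> (\<eta> x))"
      using chart_transition[OF pc(1) c(1,2)] c(3) pc(2) f by metis
    then show ?thesis by (simp add: coord_normal_eq_sgn sgn_scaleR)
  qed
  show ?thesis
    unfolding unit_normal_def
  proof (rule the_equality)
    show "\<forall>U \<phi> x'. oriented_chart U \<phi> \<and> x' \<in> U \<and> \<phi> x' = \<eta> x \<longrightarrow>
        coord_normal f \<eta> x = coord_normal f \<phi> x'"
      using eq \<eta> by metis
  qed (use \<eta> in blast)
qed

section \<open>Diffeomorphisms permute the charts\<close>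

text \<open>\<open>(f \<circ> \<phi>) \<circ> \<pi>\<close> agrees with \<open>f\<close> on
  \<open>S2 \<inter> W\<close>, so it is a local extension of \<open>f\<close> to the ambient
  space.\<close>

lemma smooth_S2_extension_differentiable:
  assumes f: "f \<in> smooth_S2" and pc: "projected_chart \<phi> \<pi> W" and "q \<in> W"
  shows "((f \<circ> \<phi>) \<circ> \<pi>) differentiable (at q)"
  using assms smooth_S2_differentiable[OF f, of UNIV \<phi>]
  by (intro differentiable_chain_at[of \<pi> q "f \<circ> \<phi>"]) (auto simp: projected_chart_def)

lemma smooth_S2_continuous_on:
  assumes f: "f \<in> smooth_S2"
  shows "continuous_on S2 f"
  unfolding continuous_on_eq_continuous_within
proof
  fix q :: "real^3" assume q: "q \<in> S2"
  then obtain \<phi> \<pi> W where pc: "projected_chart \<phi> \<pi> W" "q \<in> W"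
    using projected_chart_exists by metis
  show "continuous (at q within S2) f"
  proof (rule continuous_transform_within_openin)
    show "continuous (at q within S2) ((f \<circ> \<phi>) \<circ> \<pi>)"
      using smooth_S2_extension_differentiable[OF f pc]
      by (simp add: differentiable_at_withinI differentiable_imp_continuous_within)
    show "openin (top_of_set S2) (S2 \<inter> W)" "q \<in> S2 \<inter> W"
      "\<And>y. y \<in> S2 \<inter> W \<Longrightarrow> ((f \<circ> \<phi>) \<circ> \<pi>) y = f y"
      using pc q by (auto simp: projected_chart_def openin_open_Int)
  qed
qed

lemma diff_plus_homeomorphism:
  assumes "g \<in> diff_plus_S2"
  shows "homeomorphism S2 S2 g (inv_into S2 g)"
proof -
  have bij: "bij_betw g S2 S2" and g: "g \<in> smooth_S2" "inv_into S2 g \<in> smooth_S2"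
    using assms by (auto simp: diff_plus_S2_def)
  have bij': "bij_betw (inv_into S2 g) S2 S2" by (rule bij_betw_inv_into[OF bij])
  show ?thesis
  proof
    show "continuous_on S2 g" "continuous_on S2 (inv_into S2 g)"
      using g by (simp_all only: smooth_S2_continuous_on)
    show "g ` S2 \<subseteq> S2" "inv_into S2 g ` S2 \<subseteq> S2"
      using bij bij' by (simp_all only: bij_betw_def)
  qed (use bij in \<open>simp_all only: bij_betw_inv_into_left bij_betw_inv_into_right\<close>)
qed

text \<open>Formulated for a homeomorphism \<open>k\<close> so as to serve a diffeomorphism and its
  inverse; positivity is a hypothesis because for the inverse it has to be derived.\<close>

lemma oriented_chart_compose:
  assumes hom: "homeomorphism S2 S2 k k'" and k: "k \<in> smooth_S2" and \<phi>: "oriented_chart U \<phi>"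
    and pos: "\<And>x. x \<in> U \<Longrightarrow> area_normal (k \<circ> \<phi>) x \<bullet> k (\<phi> x) > 0"
  shows "oriented_chart U (k \<circ> \<phi>)"
proof -
  have sub: "\<phi> ` U \<subseteq> S2" using oriented_chartD(2)[OF \<phi>] by blast
  obtain \<psi> where \<psi>: "homeomorphism U (\<phi> ` U) \<phi> \<psi>" using \<phi> by (auto simp: oriented_chart_def)
  have "homeomorphism (\<phi> ` U) (k ` \<phi> ` U) k k'"
    using homeomorphism_of_subsets[OF hom sub] by blast
  from homeomorphism_compose[OF \<psi> this]
  have "homeomorphism U ((k \<circ> \<phi>) ` U) (k \<circ> \<phi>) (\<psi> \<circ> k')" by (simp add: image_comp)
  moreover have "openin (top_of_set S2) ((k \<circ> \<phi>) ` U)"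
    using homeomorphism_imp_open_map[OF hom, of "\<phi> ` U"] \<phi>
    by (simp add: oriented_chart_def image_comp)
  moreover have "smooth_on U (k \<circ> \<phi>)" using k \<phi> by (simp add: smooth_S2_def)
  ultimately show ?thesis using pos unfolding oriented_chart_def by auto
qed

lemma diff_plus_chart:
  assumes "g \<in> diff_plus_S2" "oriented_chart U \<phi>"
  shows "oriented_chart U (g \<circ> \<phi>)"
  using assms diff_plus_homeomorphism[OF assms(1)]
  by (intro oriented_chart_compose) (auto simp: diff_plus_S2_def)

text \<open>With \<open>\<eta>\<close> the inverse applied to \<open>\<phi>\<close>, one has
  \<open>\<phi> = g \<circ> \<eta>\<close> on \<open>U\<close>. Passing to a projected chart,
  \<open>g \<circ> \<eta>\<close> and \<open>\<eta>\<close> acquire the same determinant: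
  orientation of \<open>\<phi>\<close> and of \<open>g\<close> makes it positive, and then
  \<open>\<eta>\<close> is oriented.\<close>

lemma diff_plus_inv_chart:
  assumes g: "g \<in> diff_plus_S2" and \<phi>: "oriented_chart U \<phi>"
  shows "oriented_chart U (inv_into S2 g \<circ> \<phi>)"
proof (rule oriented_chart_compose[OF homeomorphism_symD[OF diff_plus_homeomorphism[OF g]] _ \<phi>])
  show inv: "inv_into S2 g \<in> smooth_S2" using g by (simp add: diff_plus_S2_def)
  fix x assume x: "x \<in> U"
  define \<eta> where "\<eta> = inv_into S2 g \<circ> \<phi>"
  have hom: "homeomorphism S2 S2 g (inv_into S2 g)" by (rule diff_plus_homeomorphism[OF g])
  have \<eta>S2: "\<eta> y \<in> S2" and g\<eta>: "g (\<eta> y) = \<phi> y" if "y \<in> U" for y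
    using hom oriented_chartD(2)[OF \<phi> that] unfolding homeomorphism_def \<eta>_def by auto
  have \<eta>: "\<eta> differentiable (at x)"
    unfolding \<eta>_def using smooth_S2_differentiable[OF inv \<phi> x] .
  obtain \<phi>' \<pi> W where pc: "projected_chart \<phi>' \<pi> W" "\<eta> x \<in> W"
    using projected_chart_exists \<eta>S2[OF x] by metis
  let ?d = "det (jacobian (\<pi> \<circ> \<eta>) (at x))" and ?z = "\<pi> (\<eta> x)"
  have \<phi>': "oriented_chart UNIV \<phi>'" using pc by (simp add: projected_chart_def)
  have z: "\<phi>' ?z = \<eta> x"
    using pc \<eta>S2[OF x] by (simp add: projected_chart_def)
  note tr = area_normal_transition[OF pc(1) oriented_chartD(1)[OF \<phi>] x \<eta>S2 \<eta> pc(2)]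
  have "area_normal \<phi> x = area_normal (g \<circ> \<eta>) x"
    using jacobian_cong_open[OF oriented_chartD(1)[OF \<phi>] x, of \<phi> "g \<circ> \<eta>"] g\<eta> by simp
  also have "\<dots> = ?d *\<^sub>R area_normal (g \<circ> \<phi>') ?z"
    using tr smooth_S2_differentiable[OF _ \<phi>'] g by (simp add: diff_plus_S2_def)
  finally have "area_normal \<phi> x \<bullet> \<phi> x = ?d * (area_normal (g \<circ> \<phi>') ?z \<bullet> g (\<phi>' ?z))"
    using g\<eta>[OF x] z by simp
  moreover have "area_normal \<phi> x \<bullet> \<phi> x > 0" by (rule oriented_chartD(4)[OF \<phi> x])
  moreover have "area_normal (g \<circ> \<phi>') ?z \<bullet> g (\<phi>' ?z) > 0"
    using g \<phi>' by (simp add: diff_plus_S2_def)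
  ultimately have "?d > 0" by (simp add: zero_less_mult_iff)
  moreover have "area_normal \<eta> x = ?d *\<^sub>R area_normal \<phi>' ?z"
    using tr[of id] oriented_chartD(3)[OF \<phi>'] by simp
  ultimately show "area_normal (inv_into S2 g \<circ> \<phi>) x \<bullet> inv_into S2 g (\<phi> x) > 0"
    using oriented_chartD(4)[OF \<phi>', of ?z] z by (simp add: \<eta>_def)
qed

lemma smooth_S2_compose_diff_plus:
  assumes "f \<in> smooth_S2" "g \<in> diff_plus_S2"
  shows "f \<circ> g \<in> smooth_S2"
  using assms diff_plus_chart[OF assms(2)] by (simp add: smooth_S2_def comp_assoc)

text \<open>Reading \<open>f \<circ> g\<close> in a chart \<open>\<phi>\<close> is reading
  \<open>f\<close> in the oriented chart \<open>g \<circ> \<phi>\<close>.\<close>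

lemma unit_normal_compose_diff_plus:
  assumes f: "f \<in> smooth_S2" and g: "g \<in> diff_plus_S2" and p: "p \<in> S2"
  shows "unit_normal (f \<circ> g) p = unit_normal f (g p)"
proof -
  obtain \<phi> \<pi> W where pc: "projected_chart \<phi> \<pi> W" "p \<in> W"
    using projected_chart_exists p by metis
  then have \<phi>: "oriented_chart UNIV \<phi>" and z: "\<phi> (\<pi> p) = p"
    using p by (auto simp: projected_chart_def)
  have "unit_normal (f \<circ> g) p = coord_normal (f \<circ> g) \<phi> (\<pi> p)"
    using unit_normal_eq[OF smooth_S2_compose_diff_plus[OF f g] \<phi>, of "\<pi> p"] z by simp
  also have "\<dots> = coord_normal f (g \<circ> \<phi>) (\<pi> p)"
    by (simp add: coord_normal_def comp_assoc)
  also have "\<dots> = unit_normal f (g p)"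
    using unit_normal_eq[OF f diff_plus_chart[OF g \<phi>], of "\<pi> p"] z by simp
  finally show ?thesis .
qed

section \<open>Invariance of the integral\<close>

text \<open>Only the parametrizations change, the plane sets stay. Injectivity of \<open>k\<close>
  keeps the pieces disjoint, surjectivity keeps them covering.\<close>

lemma coordinate_partition_compose:
  assumes k: "bij_betw k S2 S2" and chart: "\<And>U \<phi>. oriented_chart U \<phi> \<Longrightarrow> oriented_chart U (k \<circ> \<phi>)"
    and P: "coordinate_partition N U \<phi> A"
  shows "coordinate_partition N U (\<lambda>i. k \<circ> \<phi> i) A"
proof -
  have sub: "\<phi> i ` A i \<subseteq> S2" if "i < N" for i
    using P that oriented_chartD(2) unfolding coordinate_partition_def by blast
  have inj: "inj_on k S2" using k by (simp only: bij_betw_def)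
  have "disjoint_family_on (\<lambda>i. (k \<circ> \<phi> i) ` A i) {..<N}"
    unfolding disjoint_family_on_def
  proof (intro ballI impI)
    fix i j assume ij: "i \<in> {..<N}" "j \<in> {..<N}" "i \<noteq> j"
    then have "\<phi> i ` A i \<inter> \<phi> j ` A j = {}"
      using P by (auto simp: coordinate_partition_def disjoint_family_on_def)
    then have "k ` (\<phi> i ` A i) \<inter> k ` (\<phi> j ` A j) = {}"
      using inj_on_image_Int[OF inj sub sub, of i j] ij by simp
    then show "(k \<circ> \<phi> i) ` A i \<inter> (k \<circ> \<phi> j) ` A j = {}" by (simp add: image_comp)
  qed
  moreover have "(\<Union>i<N. (k \<circ> \<phi> i) ` A i) = k ` (\<Union>i<N. \<phi> i ` A i)"
    by (simp add: image_UN image_comp)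
  then have "(\<Union>i<N. (k \<circ> \<phi> i) ` A i) = S2"
    using P k by (simp only: coordinate_partition_def bij_betw_def)
  ultimately show ?thesis
    using P chart by (simp add: coordinate_partition_def)
qed

text \<open>The charts composed with \<open>g\<close> are all the charts again, so both integrals are defined by the same
  condition; no change of variables takes place.\<close>

lemma S2_integral_pullback:
  assumes g: "g \<in> diff_plus_S2"
    and pull: "\<And>U \<phi> x. oriented_chart U \<phi> \<Longrightarrow> x \<in> U \<Longrightarrow> \<omega>' \<phi> x = \<omega> (g \<circ> \<phi>) x"
    and local: "\<And>U \<phi> \<phi>' x. open U \<Longrightarrow> x \<in> U \<Longrightarrow> (\<And>y. y \<in> U \<Longrightarrow> \<phi> y = \<phi>' y) \<Longrightarrow> \<omega> \<phi> x = \<omega> \<phi>' x"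
  shows "S2_integral \<omega>' = S2_integral \<omega>"
proof -
  define tot where "tot = (\<lambda>\<omega> N \<phi> A. \<Sum>i<(N::nat). set_lebesgue_integral lborel (A i :: (real^2) set)
    ((\<omega> :: (real^2 \<Rightarrow> real^3) \<Rightarrow> real^2 \<Rightarrow> real) (\<phi> i)))"
  let ?inv = "inv_into S2 g"
  have bij: "bij_betw g S2 S2" using g by (simp add: diff_plus_S2_def)
  have fwd: "coordinate_partition N U (\<lambda>i. g \<circ> \<phi> i) A"
    "tot \<omega>' N \<phi> A = tot \<omega> N (\<lambda>i. g \<circ> \<phi> i) A" if P: "coordinate_partition N U \<phi> A" for N U \<phi> A
  proof -
    show "coordinate_partition N U (\<lambda>i. g \<circ> \<phi> i) A"
      using coordinate_partition_compose[OF bij diff_plus_chart[OF g] P] .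
    show "tot \<omega>' N \<phi> A = tot \<omega> N (\<lambda>i. g \<circ> \<phi> i) A"
      unfolding tot_def
    proof (intro sum.cong refl set_lebesgue_integral_cong allI impI)
      fix i x assume "i \<in> {..<N}"
      then have i: "oriented_chart (U i) (\<phi> i)" "A i \<in> sets borel" "A i \<subseteq> U i"
        using P by (auto simp: coordinate_partition_def)
      show "A i \<in> sets lborel" using i by simp
      show "\<omega>' (\<phi> i) x = \<omega> (g \<circ> \<phi> i) x" if "x \<in> A i" using pull i that by blast
    qed
  qed
  have bwd: "coordinate_partition N U (\<lambda>i. ?inv \<circ> \<phi> i) A"
    "tot \<omega>' N (\<lambda>i. ?inv \<circ> \<phi> i) A = tot \<omega> N \<phi> A" if P: "coordinate_partition N U \<phi> A" for N U \<phi> A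
  proof -
    show P': "coordinate_partition N U (\<lambda>i. ?inv \<circ> \<phi> i) A"
      using coordinate_partition_compose[OF bij_betw_inv_into[OF bij] diff_plus_inv_chart[OF g] P] .
    \<comment> \<open>The two parametrizations agree on \<open>U i\<close> but may differ outside,
      where \<open>\<phi> i\<close> can leave the sphere; locality of \<open>\<omega>\<close>
      absorbs this.\<close>
    have "tot \<omega> N (\<lambda>i. g \<circ> (?inv \<circ> \<phi> i)) A = tot \<omega> N \<phi> A"
      unfolding tot_def
    proof (intro sum.cong refl set_lebesgue_integral_cong allI impI)
      fix i x assume "i \<in> {..<N}"
      then have i: "oriented_chart (U i) (\<phi> i)" "A i \<in> sets borel" "A i \<subseteq> U i"
        using P by (auto simp: coordinate_partition_def)
      show "A i \<in> sets lborel" using i by simp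
      show "\<omega> (g \<circ> (?inv \<circ> \<phi> i)) x = \<omega> (\<phi> i) x" if "x \<in> A i"
      proof (rule local[OF oriented_chartD(1)[OF i(1)]])
        show "x \<in> U i" using i that by blast
        show "(g \<circ> (?inv \<circ> \<phi> i)) y = \<phi> i y" if "y \<in> U i" for y
          using bij_betw_inv_into_right[OF bij oriented_chartD(2)[OF i(1) that]] by simp
      qed
    qed
    then show "tot \<omega>' N (\<lambda>i. ?inv \<circ> \<phi> i) A = tot \<omega> N \<phi> A"
      using fwd(2)[OF P'] by simp
  qed
  have "(\<forall>N U \<phi> A. coordinate_partition N U \<phi> A \<longrightarrow> I = tot \<omega>' N \<phi> A) \<longleftrightarrow>
      (\<forall>N U \<phi> A. coordinate_partition N U \<phi> A \<longrightarrow> I = tot \<omega> N \<phi> A)" for I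
    using fwd bwd by metis
  then show ?thesis by (simp add: S2_integral_def tot_def)
qed

section \<open>Locality and pull-back of the elastic density\<close>

lemma elastic_density_cong:
  assumes V: "open V" "x \<in> V"
    and eq: "\<And>y. y \<in> V \<Longrightarrow> f (\<phi> y) = f' (\<phi>' y)" "\<And>y. y \<in> V \<Longrightarrow> df1 (\<phi> y) = df1' (\<phi>' y)"
      "\<And>y. y \<in> V \<Longrightarrow> df2 (\<phi> y) = df2' (\<phi>' y)"
  shows "elastic_density a b c f df1 df2 \<phi> x = elastic_density a b c f' df1' df2' \<phi>' x"
proof -
  \<comment> \<open>The density sees the fields only through the Jacobians at \<open>x\<close> of
    \<open>f \<circ> \<phi>\<close> and of its variations for each \<open>\<epsilon>\<close>, and
    these are determined by values near \<open>x\<close>.\<close>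
  have J: "jacobian (f \<circ> \<phi>) (at x) = jacobian (f' \<circ> \<phi>') (at x)"
    "jacobian ((\<lambda>p. f p + \<epsilon> *\<^sub>R df1 p) \<circ> \<phi>) (at x) = jacobian ((\<lambda>p. f' p + \<epsilon> *\<^sub>R df1' p) \<circ> \<phi>') (at x)"
    "jacobian ((\<lambda>p. f p + \<epsilon> *\<^sub>R df2 p) \<circ> \<phi>) (at x) = jacobian ((\<lambda>p. f' p + \<epsilon> *\<^sub>R df2' p) \<circ> \<phi>') (at x)"
    for \<epsilon>
    by (rule jacobian_cong_open[OF V]; simp add: eq)+
  show ?thesis
    by (simp only: elastic_density_def delta_metric_def delta_normal_def metric_matrix_def
        coord_normal_def J)
qed

lemma elastic_metric_pullback:
  assumes g: "g \<in> diff_plus_S2"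
    and eq: "\<And>p. p \<in> S2 \<Longrightarrow> df1' p = df1 (g p)" "\<And>p. p \<in> S2 \<Longrightarrow> df2' p = df2 (g p)"
  shows "elastic_metric a b c (f \<circ> g) df1' df2' = elastic_metric a b c f df1 df2"
  unfolding elastic_metric_def
proof (rule S2_integral_pullback[OF g])
  fix U :: "(real^2) set" and \<phi> \<phi>' :: "real^2 \<Rightarrow> real^3" and x
  show "elastic_density a b c (f \<circ> g) df1' df2' \<phi> x = elastic_density a b c f df1 df2 (g \<circ> \<phi>) x"
    if "oriented_chart U \<phi>" "x \<in> U"
    by (rule elastic_density_cong[OF oriented_chartD(1)[OF that(1)] that(2)])
      (simp_all only: comp_apply eq oriented_chartD(2)[OF that(1)])
  show "elastic_density a b c f df1 df2 \<phi> x = elastic_density a b c f df1 df2 \<phi>' x"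
    if "open U" "x \<in> U" "\<And>y. y \<in> U \<Longrightarrow> \<phi> y = \<phi>' y"
    by (rule elastic_density_cong[OF that(1,2)]) (simp_all only: that(3))
qed

section \<open>The velocity of a reparametrized path\<close>

text \<open>Links the difference quotients in \<open>smooth_path\<close> to the calculus of
  \<open>has_vector_derivative\<close>.\<close>

lemma has_vector_derivative_iff_quotient:
  "(f has_vector_derivative y) (at t within S) \<longleftrightarrow>
    ((\<lambda>s. (f s - f t) /\<^sub>R (s - t)) \<longlongrightarrow> y) (at t within S)"
proof -
  have "norm (f s - f t - (s - t) *\<^sub>R y) / norm (s - t) = norm ((f s - f t) /\<^sub>R (s - t) - y)"
    if "s \<noteq> t" for s
  proof -
    have "(f s - f t) /\<^sub>R (s - t) - y = (f s - f t - (s - t) *\<^sub>R y) /\<^sub>R (s - t)"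
      using that by (simp add: scaleR_diff_right)
    then show ?thesis by (simp add: divide_inverse mult.commute)
  qed
  then have "((\<lambda>s. norm (f s - f t - (s - t) *\<^sub>R y) / norm (s - t)) \<longlongrightarrow> 0) (at t within S) \<longleftrightarrow>
      ((\<lambda>s. norm ((f s - f t) /\<^sub>R (s - t) - y)) \<longlongrightarrow> 0) (at t within S)"
    by (intro Lim_cong_within refl)
  also have "\<dots> \<longleftrightarrow> ((\<lambda>s. (f s - f t) /\<^sub>R (s - t)) \<longlongrightarrow> y) (at t within S)"
    by (simp only: tendsto_norm_zero_iff LIM_zero_iff)
  finally show ?thesis
    by (simp add: has_vector_derivative_def has_derivative_iff_norm bounded_linear_scaleR_left)
qed

section \<open>First-order consequences of smoothness of a path\<close>

lemma smooth_path_facts: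
  assumes "smooth_path \<Psi>" "t \<in> {0..1}"
  shows "\<Psi> t \<in> smooth_S2" "path_deriv \<Psi> t \<in> smooth_S2"
    "smooth_limit (\<lambda>s p. (\<Psi> s p - \<Psi> t p) /\<^sub>R (s - t)) (path_deriv \<Psi> t) (at t within {0..1})"
proof -
  have k: "(path_deriv ^^ k) \<Psi> t \<in> smooth_S2 \<and>
      smooth_limit (\<lambda>s p. ((path_deriv ^^ k) \<Psi> s p - (path_deriv ^^ k) \<Psi> t p) /\<^sub>R (s - t))
        ((path_deriv ^^ Suc k) \<Psi> t) (at t within {0..1})" for k
    using assms unfolding smooth_path_def by blast
  from k[of 0] show "\<Psi> t \<in> smooth_S2"
    "smooth_limit (\<lambda>s p. (\<Psi> s p - \<Psi> t p) /\<^sub>R (s - t)) (path_deriv \<Psi> t) (at t within {0..1})"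
    by simp_all
  from k[of 1] show "path_deriv \<Psi> t \<in> smooth_S2" by simp
qed

lemma smooth_limit_uniform:
  assumes "smooth_limit H h F" "oriented_chart U \<phi>" "compact K" "K \<subseteq> U"
  shows "uniform_limit K (\<lambda>s. H s \<circ> \<phi>) (h \<circ> \<phi>) F"
proof -
  have "uniform_limit K (\<lambda>s. partials [] (H s \<circ> \<phi>)) (partials [] (h \<circ> \<phi>)) F"
    using assms unfolding smooth_limit_def by blast
  then show ?thesis by simp
qed

text \<open>Uniform convergence on the compact set \<open>{\<pi> p}\<close>, with no partial
  derivative taken, is pointwise convergence of the difference quotients.\<close>

lemma smooth_path_has_vector_derivative:
  assumes \<Psi>: "smooth_path \<Psi>" and t: "t \<in> {0..1}" and p: "p \<in> S2"
  shows "((\<lambda>s. \<Psi> s p) has_vector_derivative path_deriv \<Psi> t p) (at t within {0..1})"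
proof -
  obtain \<phi> \<pi> W where pc: "projected_chart \<phi> \<pi> W" "p \<in> W"
    using projected_chart_exists p by metis
  then have \<phi>: "oriented_chart UNIV \<phi>" and z: "\<phi> (\<pi> p) = p"
    using p by (auto simp: projected_chart_def)
  have "uniform_limit {\<pi> p} (\<lambda>s. (\<lambda>p. (\<Psi> s p - \<Psi> t p) /\<^sub>R (s - t)) \<circ> \<phi>) (path_deriv \<Psi> t \<circ> \<phi>)
      (at t within {0..1})"
    by (rule smooth_limit_uniform[OF smooth_path_facts(3)[OF \<Psi> t] \<phi>]) auto
  from tendsto_uniform_limitI[OF this, of "\<pi> p"] show ?thesis
    by (simp add: has_vector_derivative_iff_quotient z)
qed

text \<open>Evaluation at a moving point: uniform convergence near \<open>q\<close> makes
  \<open>H s (y s) - h (y s)\<close> tend to 0, and \<open>h\<close> is continuous.\<close>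

lemma smooth_limit_diagonal:
  assumes H: "smooth_limit H h F" and h: "h \<in> smooth_S2"
    and y: "(y \<longlongrightarrow> q) F" "\<forall>\<^sub>F s in F. y s \<in> S2" and q: "q \<in> S2"
  shows "((\<lambda>s. H s (y s)) \<longlongrightarrow> h q) F"
proof -
  obtain \<phi> \<pi> W where pc: "projected_chart \<phi> \<pi> W" "q \<in> W"
    using projected_chart_exists q by metis
  then have \<phi>: "oriented_chart UNIV \<phi>" by (simp add: projected_chart_def)
  \<comment> \<open>The radius 1 is arbitrary, as the chart is defined on the whole plane.\<close>
  let ?K = "cball (\<pi> q) 1"
  have U: "uniform_limit ?K (\<lambda>s. H s \<circ> \<phi>) (h \<circ> \<phi>) F"
    by (rule smooth_limit_uniform[OF H \<phi>]) auto
  have "isCont \<pi> q"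
    using pc by (simp add: projected_chart_def differentiable_imp_continuous_within)
  then have "((\<lambda>s. \<pi> (y s)) \<longlongrightarrow> \<pi> q) F" using y(1) by (rule isCont_tendsto_compose)
  then have "\<forall>\<^sub>F s in F. \<pi> (y s) \<in> ball (\<pi> q) 1"
    by (rule topological_tendstoD) auto
  moreover have "\<forall>\<^sub>F s in F. y s \<in> W"
    using y(1) pc by (intro topological_tendstoD) (auto simp: projected_chart_def)
  ultimately have loc: "\<forall>\<^sub>F s in F. \<pi> (y s) \<in> ?K \<and> \<phi> (\<pi> (y s)) = y s"
    using y(2) by eventually_elim (use pc in \<open>auto simp: projected_chart_def\<close>)
  have "((\<lambda>s. H s (y s) - h (y s)) \<longlongrightarrow> 0) F"
  proof (rule tendstoI)
    fix e :: real assume "e > 0"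
    from uniform_limitD[OF U this] loc
    show "\<forall>\<^sub>F s in F. dist (H s (y s) - h (y s)) 0 < e"
      by eventually_elim (auto simp: dist_norm dest!: bspec)
  qed
  moreover have "((\<lambda>s. h (y s)) \<longlongrightarrow> h q) F"
    using continuous_on_tendsto_compose[OF smooth_S2_continuous_on[OF h] y(1) q y(2)] .
  ultimately show ?thesis using tendsto_add by fastforce
qed

text \<open>The ambient extension of \<open>f\<close> lets the chain rule act along the curve. The
  velocity lies in the range of the derivative of \<open>f \<circ> \<phi>\<close>, whose two columns
  are orthogonal to their cross product and hence to the normal.\<close>

lemma smooth_S2_along_curve:
  assumes f: "f \<in> smooth_S2" and y: "(y has_vector_derivative k) (at t within S)"
    and S2: "\<And>s. s \<in> S \<Longrightarrow> y s \<in> S2" and t: "t \<in> S"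
  obtains v where "((\<lambda>s. f (y s)) has_vector_derivative v) (at t within S)"
    "v \<bullet> unit_normal f (y t) = 0"
proof -
  obtain \<phi> \<pi> W where pc: "projected_chart \<phi> \<pi> W" "y t \<in> W"
    using projected_chart_exists S2[OF t] by metis
  then have \<phi>: "oriented_chart UNIV \<phi>" and z: "\<phi> (\<pi> (y t)) = y t" and W: "open W"
    using S2[OF t] by (auto simp: projected_chart_def)
  obtain L where L: "(f \<circ> \<phi> has_derivative L) (at (\<pi> (y t)))"
    using smooth_S2_differentiable[OF f \<phi>] by (auto simp: differentiable_def)
  obtain M where M: "(\<pi> has_derivative M) (at (y t))"
    using pc by (auto simp: projected_chart_def differentiable_def)
  have "((f \<circ> \<phi>) \<circ> \<pi> has_derivative L \<circ> M) (at (y t))" by (rule diff_chain_at[OF M L])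
  then have chain: "((\<lambda>s. f (\<phi> (\<pi> (y s)))) has_vector_derivative (L \<circ> M) k) (at t within S)"
    using vector_derivative_diff_chain_within[OF y has_derivative_at_withinI] by (simp add: o_def)
  have "(y \<longlongrightarrow> y t) (at t within S)"
    using has_vector_derivative_continuous[OF y] by (simp add: continuous_within)
  then have "\<forall>\<^sub>F s in at t within S. y s \<in> W"
    using W pc(2) by (rule topological_tendstoD)
  \<comment> \<open>The point \<open>s = t\<close> is left out here; there membership in
    \<open>W\<close> comes from the choice of the chart.\<close>
  then obtain d where d: "d > 0" "\<And>s. s \<in> S \<Longrightarrow> s \<noteq> t \<Longrightarrow> dist s t < d \<Longrightarrow> y s \<in> W"
    unfolding eventually_at by blast
  have "((\<lambda>s. f (y s)) has_vector_derivative (L \<circ> M) k) (at t within S)"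
  proof (rule has_vector_derivative_transform_within[OF chain d(1) t])
    fix s assume "s \<in> S" "dist s t < d"
    then show "f (\<phi> (\<pi> (y s))) = f (y s)"
      using d(2)[of s] pc S2[of s] by (cases "s = t") (auto simp: projected_chart_def)
  qed
  moreover have "L w \<bullet> unit_normal f (y t) = 0" for w
  proof -
    have "unit_normal f (y t) = sgn (cross3 (L (axis 1 1)) (L (axis 2 1)))"
      using unit_normal_eq[OF f \<phi>, of "\<pi> (y t)"] z
      by (simp add: coord_normal_eq_sgn column_jacobian[OF L])
    then show ?thesis
      by (subst linear_axis_2[OF has_derivative_linear[OF L]])
        (simp add: inner_add_left sgn_div_norm dot_cross_self)
  qed
  ultimately show ?thesis using that by simp
qed

text \<open>The difference quotient splits at \<open>\<Psi> t (\<gamma> s p)\<close>: one part is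
  the quotient of \<open>\<Psi>\<close> at the moving point \<open>\<gamma> s p\<close>, the other
  that of the fixed map \<open>\<Psi> t\<close> along a curve on the sphere, with tangential
  limit.\<close>

lemma path_deriv_reparametrized:
  assumes \<Psi>: "smooth_path \<Psi>" and \<gamma>: "smooth_path \<gamma>" and t: "t \<in> {0..1}" and p: "p \<in> S2"
    and S2: "\<And>s. s \<in> {0..1} \<Longrightarrow> \<gamma> s p \<in> S2"
  obtains v where "path_deriv (\<lambda>t. \<Psi> t \<circ> \<gamma> t) t p = path_deriv \<Psi> t (\<gamma> t p) + v"
    "v \<bullet> unit_normal (\<Psi> t) (\<gamma> t p) = 0"
proof -
  let ?F = "at t within {0..1}" and ?y = "\<lambda>s. \<gamma> s p"
  have y: "(?y has_vector_derivative path_deriv \<gamma> t p) ?F"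
    by (rule smooth_path_has_vector_derivative[OF \<gamma> t p])
  obtain v where v: "((\<lambda>s. \<Psi> t (?y s)) has_vector_derivative v) ?F"
    "v \<bullet> unit_normal (\<Psi> t) (?y t) = 0"
    using smooth_S2_along_curve[OF smooth_path_facts(1)[OF \<Psi> t] y S2 t] by metis
  have "(?y \<longlongrightarrow> ?y t) ?F"
    using has_vector_derivative_continuous[OF y] by (simp add: continuous_within)
  moreover have "\<forall>\<^sub>F s in ?F. ?y s \<in> S2"
    using S2 by (auto simp only: eventually_at_filter intro!: always_eventually)
  ultimately have "((\<lambda>s. (\<Psi> s (?y s) - \<Psi> t (?y s)) /\<^sub>R (s - t)) \<longlongrightarrow> path_deriv \<Psi> t (?y t)) ?F"
    using smooth_limit_diagonal[OF smooth_path_facts(3,2)[OF \<Psi> t]] S2[OF t] by blast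
  from tendsto_add[OF this v(1)[unfolded has_vector_derivative_iff_quotient]]
  have "((\<lambda>s. \<Psi> s (?y s)) has_vector_derivative path_deriv \<Psi> t (?y t) + v) ?F"
    unfolding has_vector_derivative_iff_quotient
    by (simp add: scaleR_add_right[symmetric])
  \<comment> \<open>Derivatives within \<open>{0..1}\<close> are unique also at the end points,
    since the interval is nondegenerate.\<close>
  then have "path_deriv (\<lambda>t. \<Psi> t \<circ> \<gamma> t) t p = path_deriv \<Psi> t (?y t) + v"
    unfolding path_deriv_def o_def using t
    by (intro vector_derivative_within_closed_interval) auto
  with v(2) that show ?thesis by blast
qed

section \<open>Equality of the two lengths\<close>

theorem mainTheorem2:
  fixes a b c :: real
    and \<Psi> \<gamma> :: "real \<Rightarrow> real^3 \<Rightarrow> real^3"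
  assumes "a \<ge> 0" and "b \<ge> 0" and "c \<ge> 0"
    and "smooth_path \<Psi>" and "\<And>t. t \<in> {0..1} \<Longrightarrow> \<Psi> t \<in> embeddings_S2"
    and "smooth_path \<gamma>" and "\<And>t. t \<in> {0..1} \<Longrightarrow> \<gamma> t \<in> diff_plus_S2"
  shows "path_length a b c \<Psi> = path_length a b c (\<lambda>t. \<Psi> t \<circ> \<gamma> t)"
proof -
  let ?\<Phi> = "\<lambda>t. \<Psi> t \<circ> \<gamma> t"
  have "normal_elastic_metric a b c (\<Psi> t) (path_deriv \<Psi> t) (path_deriv \<Psi> t) =
      normal_elastic_metric a b c (?\<Phi> t) (path_deriv ?\<Phi> t) (path_deriv ?\<Phi> t)"
    if t: "t \<in> {0..1}" for t
  proof -
    have S2: "\<gamma> s p \<in> S2" if "s \<in> {0..1}" "p \<in> S2" for s p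
      using assms(7)[OF that(1)] that(2) bij_betwE unfolding diff_plus_S2_def by blast
    \<comment> \<open>The tangential term \<open>v\<close> drops out of the inner product with the
      normal.\<close>
    have "normal_part (?\<Phi> t) (path_deriv ?\<Phi> t) p = normal_part (\<Psi> t) (path_deriv \<Psi> t) (\<gamma> t p)"
      if p: "p \<in> S2" for p
    proof -
      have "unit_normal (?\<Phi> t) p = unit_normal (\<Psi> t) (\<gamma> t p)"
        by (rule unit_normal_compose_diff_plus[OF smooth_path_facts(1)[OF assms(4) t] assms(7)[OF t] p])
      moreover obtain v where "path_deriv ?\<Phi> t p = path_deriv \<Psi> t (\<gamma> t p) + v"
        "v \<bullet> unit_normal (\<Psi> t) (\<gamma> t p) = 0"
        using path_deriv_reparametrized[OF assms(4,6) t p S2[OF _ p]] by metis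
      ultimately show ?thesis by (simp add: normal_part_def inner_add_left)
    qed
    then show ?thesis
      unfolding normal_elastic_metric_def
      by (intro elastic_metric_pullback[OF assms(7)[OF t], symmetric])
  qed
  then show ?thesis
    unfolding path_length_def by (intro integral_cong) simp
qed

end
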